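(* Let $\mathcal{P}_1$ be the set of degree-$\le1$ polynomials from $\{0,1\}^n$ to $\mathbb{R}$. There are absolute constants $c,C>0$ such that for every $\delta< c\log\log n/\log n$, $\mathcal{P}_1$ has a $(\delta,q)$-local correction algorithm with $q\le C\log n/\log\log n$.
   Context: $\mathcal{P}_1$ consists of the functions $x\mapsto a_0+\sum_{i=1}^n a_ix_i$ with $a_i\in\mathbb{R}$, $x\in\{0,1\}^n$. $\delta(f,P)=\Pr_{x\sim\{0,1\}^n}[f(x)\ne P(x)]$. A class $\mathcal{F}$ has a $(\delta,q)$-local correction algorithm if there is a probabilistic algorithm that, given oracle access to any $f$ with $\delta(f,P)\le\delta$ for some $P\in\mathcal{F}$ and any input $a\in\{0,1\}^n$, outputs $P(a)$ with probability at least $3/4$ using at most $q$ queries. *)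

theory Defs
  imports "HOL-Probability.Probability"
begin

definition cube :: "nat \<Rightarrow> (nat \<Rightarrow> real) set" where
  "cube n = ({1..n} \<rightarrow>\<^sub>E {0, 1})"

text \<open>Membership constrains a function on the cube only; its values elsewhere are irrelevant.\<close>

definition poly_deg_le_1 :: "nat \<Rightarrow> ((nat \<Rightarrow> real) \<Rightarrow> real) set" where
  "poly_deg_le_1 n =
     {P. \<exists>(a0 :: real) (a :: nat \<Rightarrow> real). \<forall>x \<in> cube n. P x = a0 + (\<Sum>i = 1..n. a i * x i)}"

definition rel_dist :: "nat \<Rightarrow> ((nat \<Rightarrow> real) \<Rightarrow> real) \<Rightarrow> ((nat \<Rightarrow> real) \<Rightarrow> real) \<Rightarrow> real" where
  "rel_dist n f P = measure_pmf.prob (pmf_of_set (cube n)) {x. f x \<noteq> P x}"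

text \<open>Deterministic adaptive query algorithms with queries in \<open>'x\<close>, oracle answers in \<open>'y\<close> and
  output in \<open>'r\<close>. A probabilistic oracle algorithm is a distribution over these: its coins are
  tossed in advance.\<close>

datatype ('x, 'y, 'r) query_tree =
    Output 'r
  | Query 'x "'y \<Rightarrow> ('x, 'y, 'r) query_tree"

primrec run :: "('x \<Rightarrow> 'y) \<Rightarrow> ('x, 'y, 'r) query_tree \<Rightarrow> 'r" where
  "run f (Output r) = r"
| "run f (Query x k) = run f (k (f x))"

primrec queries :: "('x \<Rightarrow> 'y) \<Rightarrow> ('x, 'y, 'r) query_tree \<Rightarrow> 'x list" where
  "queries f (Output r) = []"
| "queries f (Query x k) = x # queries f (k (f x))"

text \<open>The algorithm depends on the input point \<open>a\<close> but not on \<open>f\<close> or \<open>P\<close>. The query bound holds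
  for every oracle and every outcome of the coins.\<close>

definition has_local_correction ::
    "nat \<Rightarrow> ((nat \<Rightarrow> real) \<Rightarrow> real) set \<Rightarrow> real \<Rightarrow> nat \<Rightarrow> bool" where
  "has_local_correction n F \<delta> q \<longleftrightarrow>
     (\<exists>A :: (nat \<Rightarrow> real) \<Rightarrow> (nat \<Rightarrow> real, real, real) query_tree pmf.
        (\<forall>a \<in> cube n. \<forall>T \<in> set_pmf (A a). \<forall>f.
            length (queries f T) \<le> q \<and> set (queries f T) \<subseteq> cube n) \<and>
        (\<forall>f. \<forall>P \<in> F. rel_dist n f P \<le> \<delta> \<longrightarrow>
            (\<forall>a \<in> cube n. measure_pmf.prob (A a) {T. run f T = P a} \<ge> 3 / 4)))"

end

theory Submission
  imports
    Defs
    "HOL-Library.Function_Algebras"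
    "HOL-Library.Nat_Bijection"
    "HOL-Probability.Product_PMF"
begin

text \<open>To correct at \<open>a\<close>, each coordinate \<open>i\<close> independently draws a random column of a sign matrix
  with \<open>k\<close> rows, and the \<open>r\<close>-th query flips \<open>a\<^sub>i\<close> according to the \<open>r\<close>-th entry. If a fixed
  combination of the rows, with coefficients of sum \<open>1\<close>, is identically \<open>1\<close>, then the same
  combination of the answers of an affine polynomial is its value at \<open>a\<close>. If every row has bias at most \<open>1 / n\<close>,
  each query has density at most \<open>(1 + 1 / n)\<^sup>n \<le> 3\<close> with respect to the uniform distribution, so a
  union bound tolerates \<open>\<delta> \<le> 1 / (12 k)\<close>.

  Such a matrix comes from sign vectors that span everything and a vector \<open>w\<close> whose inner products
  with them are \<open>0\<close> or \<open>1\<close>, although the sum of all \<open>\<bar>w\<^sub>t\<bar>\<close> is at least \<open>n\<close>: draw column \<open>t\<close> with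
  probability proportional to \<open>\<bar>w\<^sub>t\<bar>\<close> and multiply it by the sign of \<open>w\<^sub>t\<close>. In the manner of Hastad
  and Alon-Vu, columns are indexed by the subsets of a set of size \<open>s + 3\<close>, and \<open>w\<close> is prescribed by
  its Walsh transform, which grows to \<open>2 ^ (2 ^ s * (s + 2) / 2)\<close>, that is \<open>k ^ \<Omega>(k)\<close> for a number
  \<open>k \<le> 10 * 2 ^ s\<close> of rows. Hence \<open>k = O(log n / log log n)\<close> queries suffice.\<close>

section \<open>Linear correction algorithms\<close>

primrec linear_query_tree :: "(real \<times> 'x) list \<Rightarrow> real \<Rightarrow> ('x, real, real) query_tree" where
  "linear_query_tree [] acc = Output acc"
| "linear_query_tree (cx # l) acc = Query (snd cx) (\<lambda>y. linear_query_tree l (acc + fst cx * y))"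

lemma run_linear_query_tree: "run f (linear_query_tree l acc) = acc + (\<Sum>(c, x)\<leftarrow>l. c * f x)"
  by (induction l arbitrary: acc) auto

lemma queries_linear_query_tree: "queries f (linear_query_tree l acc) = map snd l"
  by (induction l arbitrary: acc) auto

lemma finite_cube [simp]: "finite (cube n)"
  by (simp add: cube_def finite_PiE)

lemma card_cube: "card (cube n) = 2 ^ n"
  by (simp add: cube_def card_PiE numeral_2_eq_2)

lemma cube_nonempty: "cube n \<noteq> {}"
  by (simp add: cube_def PiE_eq_empty_iff)

lemma prob_le_density_times_uniform:
  fixes q :: "'a pmf"
  assumes S: "finite S" "S \<noteq> {}" "set_pmf q \<subseteq> S"
    and density: "\<And>x. x \<in> S \<Longrightarrow> pmf q x \<le> K / card S"
  shows "measure_pmf.prob q A \<le> K * measure_pmf.prob (pmf_of_set S) A"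
proof -
  have "measure_pmf.prob q A = measure_pmf.prob q (S \<inter> A)"
    using S(3) by (intro measure_eq_AE) (auto simp: AE_measure_pmf_iff)
  also have "\<dots> = sum (pmf q) (S \<inter> A)"
    using S(1) by (simp add: measure_measure_pmf_finite)
  also have "\<dots> \<le> (\<Sum>x\<in>S \<inter> A. K / card S)"
    by (intro sum_mono density) auto
  also have "\<dots> = K * measure_pmf.prob (pmf_of_set S) A"
    using S by (simp add: measure_pmf_of_set)
  finally show ?thesis .
qed

lemma prob_linear_combination_neq_le:
  fixes c :: "'r \<Rightarrow> real" and f P :: "'x \<Rightarrow> real" and \<epsilon> :: real
  assumes R: "finite R"
    and reproduces: "\<And>\<tau>. \<tau> \<in> set_pmf Q \<Longrightarrow> (\<Sum>r\<in>R. c r * P (z \<tau> r)) = v"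
    and error: "\<And>r. r \<in> R \<Longrightarrow> measure_pmf.prob Q {\<tau>. f (z \<tau> r) \<noteq> P (z \<tau> r)} \<le> \<epsilon>"
  shows "measure_pmf.prob Q {\<tau>. (\<Sum>r\<in>R. c r * f (z \<tau> r)) \<noteq> v} \<le> card R * \<epsilon>"
proof -
  let ?bad = "\<lambda>r. {\<tau>. f (z \<tau> r) \<noteq> P (z \<tau> r)}"
  have "measure_pmf.prob Q {\<tau>. (\<Sum>r\<in>R. c r * f (z \<tau> r)) \<noteq> v} \<le> measure_pmf.prob Q (\<Union>r\<in>R. ?bad r)"
  proof (rule measure_pmf.finite_measure_mono_AE)
    have "\<exists>r\<in>R. f (z \<tau> r) \<noteq> P (z \<tau> r)"
      if "\<tau> \<in> set_pmf Q" "(\<Sum>r\<in>R. c r * f (z \<tau> r)) \<noteq> v" for \<tau>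
      using reproduces[OF that(1)] that(2) by (metis (no_types, lifting) sum.cong)
    then show "AE \<tau> in Q. \<tau> \<in> {\<tau>. (\<Sum>r\<in>R. c r * f (z \<tau> r)) \<noteq> v} \<longrightarrow> \<tau> \<in> (\<Union>r\<in>R. ?bad r)"
      by (auto simp: AE_measure_pmf_iff)
  qed simp
  also have "\<dots> \<le> (\<Sum>r\<in>R. measure_pmf.prob Q (?bad r))"
    using R by (intro measure_pmf.finite_measure_subadditive_finite) auto
  also have "\<dots> \<le> (\<Sum>r\<in>R. \<epsilon>)" by (intro sum_mono error)
  finally show ?thesis by simp
qed

lemma has_local_correction_linear:
  fixes Q :: "(nat \<Rightarrow> real) \<Rightarrow> 'c pmf" and z :: "(nat \<Rightarrow> real) \<Rightarrow> 'c \<Rightarrow> 'r \<Rightarrow> nat \<Rightarrow> real"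
    and K \<delta> :: real
  assumes R: "finite R"
    and in_cube: "\<And>a \<tau> r. a \<in> cube n \<Longrightarrow> \<tau> \<in> set_pmf (Q a) \<Longrightarrow> r \<in> R \<Longrightarrow> z a \<tau> r \<in> cube n"
    and reproduces: "\<And>P a \<tau>. P \<in> F \<Longrightarrow> a \<in> cube n \<Longrightarrow> \<tau> \<in> set_pmf (Q a)
      \<Longrightarrow> (\<Sum>r\<in>R. c r * P (z a \<tau> r)) = P a"
    and density: "\<And>a x r. a \<in> cube n \<Longrightarrow> x \<in> cube n \<Longrightarrow> r \<in> R
      \<Longrightarrow> pmf (map_pmf (\<lambda>\<tau>. z a \<tau> r) (Q a)) x \<le> K / 2 ^ n"
    and K: "0 \<le> K" "card R * (K * \<delta>) \<le> 1 / 4"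
  shows "has_local_correction n F \<delta> (card R)"
proof -
  obtain rs where rs: "set rs = R" "distinct rs" using finite_distinct_list[OF R] by auto
  define alg where "alg a \<tau> = linear_query_tree (map (\<lambda>r. (c r, z a \<tau> r)) rs) 0" for a \<tau>
  have run_alg: "run f (alg a \<tau>) = (\<Sum>r\<in>R. c r * f (z a \<tau> r))" for f a \<tau>
    by (simp add: alg_def run_linear_query_tree o_def sum_list_distinct_conv_sum_set rs)
  have queries_alg: "queries f (alg a \<tau>) = map (z a \<tau>) rs" for f a \<tau>
    by (simp add: alg_def queries_linear_query_tree o_def)
  have error: "measure_pmf.prob (Q a) {\<tau>. run f (alg a \<tau>) \<noteq> P a} \<le> 1 / 4"
    if P: "P \<in> F" and dist: "rel_dist n f P \<le> \<delta>" and a: "a \<in> cube n" for f P a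
  proof -
    have "measure_pmf.prob (Q a) {\<tau>. f (z a \<tau> r) \<noteq> P (z a \<tau> r)} \<le> K * \<delta>" if r: "r \<in> R" for r
    proof -
      have "measure_pmf.prob (Q a) {\<tau>. f (z a \<tau> r) \<noteq> P (z a \<tau> r)}
          = measure_pmf.prob (map_pmf (\<lambda>\<tau>. z a \<tau> r) (Q a)) {x. f x \<noteq> P x}"
        by (simp add: vimage_def)
      also have "\<dots> \<le> K * rel_dist n f P"
        unfolding rel_dist_def
        by (rule prob_le_density_times_uniform)
          (use cube_nonempty in_cube density a r in \<open>auto simp: card_cube\<close>)
      also have "\<dots> \<le> K * \<delta>" using dist K(1) by (rule mult_left_mono)
      finally show ?thesis .
    qed
    then have "measure_pmf.prob (Q a) {\<tau>. run f (alg a \<tau>) \<noteq> P a} \<le> card R * (K * \<delta>)"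
      unfolding run_alg
      by (intro prob_linear_combination_neq_le[where P = P and z = "z a"] R reproduces P a)
    then show ?thesis using K(2) by linarith
  qed
  show ?thesis unfolding has_local_correction_def
  proof (intro exI[of _ "\<lambda>a. map_pmf (alg a) (Q a)"] conjI ballI allI impI)
    fix a T f assume a: "a \<in> cube n" and T: "T \<in> set_pmf (map_pmf (alg a) (Q a))"
    then show "length (queries f T) \<le> card R" "set (queries f T) \<subseteq> cube n"
      using in_cube rs distinct_card[OF rs(2)] by (auto simp: queries_alg)
  next
    fix f P a assume P: "P \<in> F" "rel_dist n f P \<le> \<delta>" "a \<in> cube n"
    then show "3 / 4 \<le> measure_pmf.prob (map_pmf (alg a) (Q a)) {T. run f T = P a}"
      using measure_pmf.prob_neg[of "Q a" "\<lambda>\<tau>. run f (alg a \<tau>) = P a"] error[of P f a]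
      by (simp add: vimage_def)
  qed
qed

section \<open>Correcting affine functions with sign vectors\<close>

definition flip :: "nat \<Rightarrow> (nat \<Rightarrow> real) \<Rightarrow> (nat \<Rightarrow> real) \<Rightarrow> nat \<Rightarrow> real" where
  "flip n a m = (\<lambda>i\<in>{1..n}. 1 / 2 + (a i - 1 / 2) * m i)"

lemma flip_in_cube:
  assumes "a \<in> cube n" "\<And>i. i \<in> {1..n} \<Longrightarrow> m i \<in> {1, -1}"
  shows "flip n a m \<in> cube n"
  unfolding cube_def
proof (rule PiE_I)
  fix i assume i: "i \<in> {1..n}"
  then have "a i \<in> {0, 1}" using assms(1) by (auto simp: cube_def PiE_iff)
  then show "flip n a m i \<in> {0, 1}" using assms(2)[OF i] i by (auto simp: flip_def)
qed (auto simp: flip_def)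

lemma affine_combination_flip:
  assumes P: "P \<in> poly_deg_le_1 n" and a: "a \<in> cube n"
    and in_cube: "\<And>r. r \<in> R \<Longrightarrow> flip n a (m r) \<in> cube n"
    and c: "sum c R = 1" "\<And>i. i \<in> {1..n} \<Longrightarrow> (\<Sum>r\<in>R. c r * m r i) = 1"
  shows "(\<Sum>r\<in>R. c r * P (flip n a (m r))) = P a"
proof -
  obtain b0 b where P_eq: "\<And>x. x \<in> cube n \<Longrightarrow> P x = b0 + (\<Sum>i = 1..n. b i * x i)"
    using P by (auto simp: poly_deg_le_1_def)
  have coord: "(\<Sum>r\<in>R. c r * flip n a (m r) i) = a i" if i: "i \<in> {1..n}" for i
  proof -
    have "(\<Sum>r\<in>R. c r * flip n a (m r) i) = (\<Sum>r\<in>R. c r * (1 / 2) + (a i - 1 / 2) * (c r * m r i))"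
      using i by (intro sum.cong) (auto simp: flip_def algebra_simps)
    also have "\<dots> = sum c R * (1 / 2) + (a i - 1 / 2) * (\<Sum>r\<in>R. c r * m r i)"
      by (simp only: sum.distrib sum_distrib_left sum_distrib_right)
    finally show ?thesis using c i by simp
  qed
  have "(\<Sum>r\<in>R. c r * P (flip n a (m r)))
      = (\<Sum>r\<in>R. c r * b0 + (\<Sum>i = 1..n. b i * (c r * flip n a (m r) i)))"
    by (intro sum.cong refl) (simp add: P_eq in_cube distrib_left sum_distrib_left mult_ac)
  also have "\<dots> = sum c R * b0 + (\<Sum>i = 1..n. b i * (\<Sum>r\<in>R. c r * flip n a (m r) i))"
    unfolding sum.distrib sum_distrib_left sum_distrib_right by (subst sum.swap) simp
  also have "\<dots> = P a" using c coord P_eq a by simp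
  finally show ?thesis .
qed

lemma prob_sign_eq:
  fixes p :: "'t pmf"
  assumes g: "\<And>t. t \<in> set_pmf p \<Longrightarrow> g t \<in> {1, -1 :: real}" and b: "b \<in> {1, -1}"
  shows "measure_pmf.prob p {t. g t = b} = (1 + b * measure_pmf.expectation p g) / 2"
proof -
  have int: "integrable (measure_pmf p) g"
    by (rule measure_pmf.integrable_const_bound[of _ 1])
      (use g in \<open>force simp: AE_measure_pmf_iff\<close>)+
  have "measure_pmf.prob p {t. g t = b} = measure_pmf.expectation p (indicator {t. g t = b})"
    by simp
  also have "\<dots> = measure_pmf.expectation p (\<lambda>t. (1 + b * g t) / 2)"
    using g b by (intro integral_cong_AE) (force simp: AE_measure_pmf_iff indicator_def)+
  also have "\<dots> = (1 + b * measure_pmf.expectation p g) / 2"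
    using int by simp
  finally show ?thesis .
qed

lemma pmf_random_flip_le:
  fixes p :: "'t pmf"
  assumes g: "\<And>t. t \<in> set_pmf p \<Longrightarrow> g t \<in> {1, -1 :: real}"
    and bias: "\<bar>measure_pmf.expectation p g\<bar> \<le> \<epsilon>"
    and a: "a \<in> cube n" and x: "x \<in> cube n"
  shows "pmf (map_pmf (\<lambda>\<tau>. flip n a (\<lambda>i. g (\<tau> i))) (Pi_pmf {1..n} d (\<lambda>_. p))) x
    \<le> (1 + \<epsilon>) ^ n / 2 ^ n"
proof -
  define b where "b i = (2 * a i - 1) * (2 * x i - 1)" for i
  have bit: "a i \<in> {0, 1}" "x i \<in> {0, 1}" if "i \<in> {1..n}" for i
    using a x that by (auto simp: cube_def PiE_iff)
  then have b: "b i \<in> {1, -1}" if "i \<in> {1..n}" for i using that by (fastforce simp: b_def)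
  let ?Q = "Pi_pmf {1..n} d (\<lambda>_. p)" and ?B = "\<lambda>i. {t. g t = b i}"
  have "pmf (map_pmf (\<lambda>\<tau>. flip n a (\<lambda>i. g (\<tau> i))) ?Q) x
      = measure_pmf.prob ?Q {\<tau>. flip n a (\<lambda>i. g (\<tau> i)) = x}"
    by (simp add: pmf_map vimage_def)
  also have "\<dots> \<le> measure_pmf.prob ?Q (PiE_dflt {1..n} d ?B)"
  proof (rule measure_pmf.finite_measure_mono_AE)
    have "g t = b i" if "1 / 2 + (a i - 1 / 2) * g t = x i" "i \<in> {1..n}" for t i
      using that bit[OF that(2)] by (auto simp: b_def)
    then show "AE \<tau> in ?Q. \<tau> \<in> {\<tau>. flip n a (\<lambda>i. g (\<tau> i)) = x} \<longrightarrow> \<tau> \<in> PiE_dflt {1..n} d ?B"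
      by (auto simp: AE_measure_pmf_iff set_Pi_pmf PiE_dflt_def flip_def)
  qed simp
  also have "\<dots> = (\<Prod>i\<in>{1..n}. measure_pmf.prob p (?B i))"
    by (simp add: measure_Pi_pmf_PiE_dflt)
  also have "\<dots> \<le> (\<Prod>i\<in>{1..n}. (1 + \<epsilon>) / 2)"
  proof (rule prod_mono, intro conjI)
    fix i assume "i \<in> {1..n}"
    note b_i = b[OF this]
    have "b i * measure_pmf.expectation p g \<le> \<epsilon>" using b_i bias by auto
    then show "measure_pmf.prob p (?B i) \<le> (1 + \<epsilon>) / 2"
      by (simp add: prob_sign_eq[where g = g, OF g b_i])
  qed simp
  finally show ?thesis by (simp add: power_divide)
qed

lemma one_plus_inverse_power_le_3: "(1 + 1 / real n) ^ n \<le> 3"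
proof (cases "n = 0")
  case False
  then have "(1 + 1 / real n) ^ n \<le> exp 1" by (intro exp_ge_one_plus_x_over_n_power_n) auto
  then show ?thesis using exp_le by linarith
qed simp

lemma has_local_correction_of_sign_columns:
  fixes p :: "'t pmf" and g :: "'r \<Rightarrow> 't \<Rightarrow> real" and \<delta> :: real
  assumes R: "finite R"
    and g: "\<And>r t. r \<in> R \<Longrightarrow> t \<in> set_pmf p \<Longrightarrow> g r t \<in> {1, -1}"
    and bias: "\<And>r. r \<in> R \<Longrightarrow> \<bar>measure_pmf.expectation p (g r)\<bar> \<le> 1 / real n"
    and c: "sum c R = 1" "\<And>t. t \<in> set_pmf p \<Longrightarrow> (\<Sum>r\<in>R. c r * g r t) = 1"
    and \<delta>: "card R * (3 * \<delta>) \<le> 1 / 4"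
  shows "has_local_correction n (poly_deg_le_1 n) \<delta> (card R)"
proof (rule has_local_correction_linear
    [where K = 3 and c = c and Q = "\<lambda>_. Pi_pmf {1..n} undefined (\<lambda>_. p)"
      and z = "\<lambda>a \<tau> r. flip n a (\<lambda>i. g r (\<tau> i))", OF R])
  let ?Q = "Pi_pmf {1..n} undefined (\<lambda>_. p)"
  have support: "\<tau> i \<in> set_pmf p" if "\<tau> \<in> set_pmf ?Q" "i \<in> {1..n}" for \<tau> i
    using that by (auto simp: set_Pi_pmf PiE_dflt_def)
  show in_cube: "flip n a (\<lambda>i. g r (\<tau> i)) \<in> cube n"
    if "a \<in> cube n" "\<tau> \<in> set_pmf ?Q" "r \<in> R" for a \<tau> r
    using that support by (intro flip_in_cube g) auto
  show "(\<Sum>r\<in>R. c r * P (flip n a (\<lambda>i. g r (\<tau> i)))) = P a"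
    if "P \<in> poly_deg_le_1 n" "a \<in> cube n" "\<tau> \<in> set_pmf ?Q" for P a \<tau>
    using that support by (intro affine_combination_flip in_cube c) auto
  show "pmf (map_pmf (\<lambda>\<tau>. flip n a (\<lambda>i. g r (\<tau> i))) ?Q) x \<le> 3 / 2 ^ n"
    if "a \<in> cube n" "x \<in> cube n" "r \<in> R" for a x r
  proof -
    have "pmf (map_pmf (\<lambda>\<tau>. flip n a (\<lambda>i. g r (\<tau> i))) ?Q) x \<le> (1 + 1 / real n) ^ n / 2 ^ n"
      using that by (intro pmf_random_flip_le g bias)
    also have "\<dots> \<le> 3 / 2 ^ n"
      by (intro divide_right_mono one_plus_inverse_power_le_3) simp
    finally show ?thesis .
  qed
qed (use \<delta> in auto)

lemma exists_pmf_proportional: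
  fixes w :: "'t \<Rightarrow> real"
  assumes T: "finite T" and w: "\<And>t. t \<in> T \<Longrightarrow> 0 \<le> w t" "0 < sum w T"
  obtains p :: "'t pmf" where "set_pmf p \<subseteq> T" "\<And>t. t \<in> T \<Longrightarrow> pmf p t = w t / sum w T"
proof
  define f where "f t = (if t \<in> T then w t / sum w T else 0)" for t
  have nonneg: "0 \<le> f t" for t using w by (simp add: f_def)
  have "(\<integral>\<^sup>+ t. ennreal (f t) \<partial>count_space UNIV) = (\<Sum>t\<in>T. ennreal (f t))"
    by (rule nn_integral_count_space'[OF T]) (auto simp: f_def)
  also have "\<dots> = ennreal (\<Sum>t\<in>T. w t / sum w T)"
    using w T by (subst sum_ennreal) (auto simp: f_def sum_nonneg)
  also have "\<dots> = 1" using w(2) by (simp flip: sum_divide_distrib)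
  finally have pmf_f: "pmf (embed_pmf f) t = f t" for t
    by (rule pmf_embed_pmf[OF nonneg])
  show "set_pmf (embed_pmf f) \<subseteq> T" by (auto simp: set_pmf_eq pmf_f f_def)
  show "pmf (embed_pmf f) t = w t / sum w T" if "t \<in> T" for t
    using that by (simp add: pmf_f f_def)
qed

lemma has_local_correction_of_ill_conditioned_rows:
  fixes R :: "('t \<Rightarrow> real) set" and w :: "'t \<Rightarrow> real" and \<delta> :: real
  assumes fin: "finite R" "finite T"
    and sign: "\<And>r t. r \<in> R \<Longrightarrow> t \<in> T \<Longrightarrow> r t \<in> {1, -1}"
    and spanning: "\<And>h :: 't \<Rightarrow> real. \<exists>c. \<forall>t\<in>T. (\<Sum>r\<in>R. c r * r t) = h t"
    and bounded: "\<And>r. r \<in> R \<Longrightarrow> \<bar>\<Sum>t\<in>T. w t * r t\<bar> \<le> 1"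
    and large: "0 < n" "real n \<le> (\<Sum>t\<in>T. \<bar>w t\<bar>)"
    and origin: "u \<in> T" "\<And>r. r \<in> R \<Longrightarrow> r u = 1" "0 \<le> w u"
    and \<delta>: "card R * (3 * \<delta>) \<le> 1 / 4"
  shows "has_local_correction n (poly_deg_le_1 n) \<delta> (card R)"
proof -
  define Z where "Z = (\<Sum>t\<in>T. \<bar>w t\<bar>)"
  have Z: "0 < Z" "real n \<le> Z" using large by (auto simp: Z_def)
  obtain p where p: "set_pmf p \<subseteq> T" "\<And>t. t \<in> T \<Longrightarrow> pmf p t = \<bar>w t\<bar> / Z"
    using exists_pmf_proportional[OF fin(2), of "\<lambda>t. \<bar>w t\<bar>"] Z(1) unfolding Z_def by auto
  define sg where "sg t = (if w t < 0 then -1 else 1 :: real)" for t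
  have sg: "\<bar>w t\<bar> * sg t = w t" "sg t * sg t = 1" "sg t \<in> {1, -1}" for t by (auto simp: sg_def)
  obtain c where c: "\<And>t. t \<in> T \<Longrightarrow> (\<Sum>r\<in>R. c r * r t) = sg t" using spanning[of sg] by blast
  show ?thesis
  proof (rule has_local_correction_of_sign_columns
      [where g = "\<lambda>r t. sg t * r t" and c = c and p = p, OF fin(1) _ _ _ _ \<delta>])
    show "sg t * r t \<in> {1, -1}" if "r \<in> R" "t \<in> set_pmf p" for r t
      using sign[of r t] p(1) that sg(3)[of t] by auto
    show "\<bar>measure_pmf.expectation p (\<lambda>t. sg t * r t)\<bar> \<le> 1 / real n" if r: "r \<in> R" for r
    proof -
      have "measure_pmf.expectation p (\<lambda>t. sg t * r t) = (\<Sum>t\<in>T. pmf p t * (sg t * r t))"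
        using p(1) by (subst integral_measure_pmf[OF fin(2)]) auto
      also have "\<dots> = (\<Sum>t\<in>T. \<bar>w t\<bar> * sg t * r t) / Z"
        unfolding sum_divide_distrib using p(2) by (intro sum.cong) auto
      finally have "\<bar>measure_pmf.expectation p (\<lambda>t. sg t * r t)\<bar> \<le> 1 / Z"
        using bounded[OF r] Z(1) by (simp add: sg(1) divide_right_mono)
      also have "\<dots> \<le> 1 / real n" using Z large(1) by (intro divide_left_mono) auto
      finally show ?thesis .
    qed
    show "(\<Sum>r\<in>R. c r * (sg t * r t)) = 1" if "t \<in> set_pmf p" for t
      using c[of t] sg(2)[of t] p(1) that
      by (auto simp: mult.left_commute[of _ "sg t"] simp flip: sum_distrib_left)
    have "sum c R = (\<Sum>r\<in>R. c r * r u)" by (intro sum.cong) (auto simp: origin(2))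
    then show "sum c R = 1" using c[OF origin(1)] origin(3) by (simp add: sg_def)
  qed
qed

section \<open>Walsh functions\<close>

definition walsh :: "'a set \<Rightarrow> 'a set \<Rightarrow> real" where
  "walsh a t = (-1) ^ card (a \<inter> t)"

lemma walsh_cases: "walsh a t = 1 \<or> walsh a t = -1"
  by (auto simp: walsh_def minus_one_power_iff)

lemma walsh_empty [simp]: "walsh {} t = 1" "walsh a {} = 1"
  by (simp_all add: walsh_def)

lemma walsh_commute: "walsh a t = walsh t a"
  by (simp add: walsh_def Int_commute)

lemma walsh_eq_prod:
  assumes "finite X" "a \<subseteq> X"
  shows "walsh a t = (\<Prod>x\<in>X. if x \<in> a \<inter> t then -1 else 1)"
proof -
  have "a \<inter> t = X \<inter> (a \<inter> t)" using assms(2) by auto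
  then have "walsh a t = (\<Prod>x\<in>X \<inter> (a \<inter> t). -1)" by (simp add: walsh_def)
  then show ?thesis using prod.inter_restrict[OF assms(1), of "\<lambda>_. -1 :: real" "a \<inter> t"] by simp
qed

lemma walsh_mult:
  assumes "finite a" "finite b"
  shows "walsh a t * walsh b t = walsh (sym_diff a b) t"
proof -
  have X: "finite (a \<union> b)" using assms by simp
  show ?thesis
    by (subst (1 2 3) walsh_eq_prod[OF X]) (auto simp flip: prod.distrib intro!: prod.cong)
qed

lemma sum_walsh_Pow:
  assumes X: "finite X"
  shows "(\<Sum>b\<in>Pow X. walsh b t) = 2 ^ card X * of_bool (X \<inter> t = {})"
proof -
  have "(\<Sum>b\<in>Pow X. walsh b t) = (\<Sum>b\<in>Pow X. (\<Prod>x\<in>b. if x \<in> t then -1 else 1) * (\<Prod>x\<in>X - b. 1))"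
    using X by (intro sum.cong refl)
      (auto simp: walsh_eq_prod[OF finite_subset[OF _ X]] intro: prod.cong)
  also have "\<dots> = (\<Prod>x\<in>X. (if x \<in> t then -1 else 1) + 1)"
    by (rule prod_add[OF X, symmetric])
  also have "\<dots> = 2 ^ card X * of_bool (X \<inter> t = {})"
  proof (cases "X \<inter> t = {}")
    case True
    then have "(\<Prod>x\<in>X. (if x \<in> t then -1 else 1) + 1) = (\<Prod>x\<in>X. 2 :: real)" by (intro prod.cong) auto
    then show ?thesis using True by simp
  next
    case False
    then have "(\<Prod>x\<in>X. (if x \<in> t then -1 else 1) + 1 :: real) = 0"
      using X by (auto intro!: prod_zero)
    then show ?thesis using False by simp
  qed
  finally show ?thesis .
qed

lemma walsh_orthogonal:
  assumes X: "finite X" "a \<subseteq> X" "b \<subseteq> X"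
  shows "(\<Sum>t\<in>Pow X. walsh t a * walsh t b) = (if a = b then 2 ^ card X else 0)"
proof -
  have "finite a" "finite b" using X finite_subset by auto
  then have "(\<Sum>t\<in>Pow X. walsh t a * walsh t b) = (\<Sum>t\<in>Pow X. walsh t (sym_diff a b))"
    by (simp add: walsh_mult walsh_commute[of _ a] walsh_commute[of _ b]
        walsh_commute[of _ "sym_diff a b"])
  moreover have "X \<inter> sym_diff a b = {} \<longleftrightarrow> a = b" using X by auto
  ultimately show ?thesis by (simp add: sum_walsh_Pow[OF X(1)])
qed

lemma walsh_inversion:
  assumes X: "finite X" "t \<subseteq> X"
  shows "(\<Sum>a\<in>Pow X. (\<Sum>u\<in>Pow X. h u * walsh a u) / 2 ^ card X * walsh a t) = h t"
proof -
  have "(\<Sum>a\<in>Pow X. (\<Sum>u\<in>Pow X. h u * walsh a u) / 2 ^ card X * walsh a t)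
      = (\<Sum>u\<in>Pow X. \<Sum>a\<in>Pow X. h u / 2 ^ card X * (walsh a u * walsh a t))"
    unfolding sum_divide_distrib sum_distrib_right by (subst sum.swap) (simp add: mult_ac)
  also have "\<dots> = (\<Sum>u\<in>Pow X. h u / 2 ^ card X * (if u = t then 2 ^ card X else 0))"
    using X by (intro sum.cong refl, subst sum_distrib_left[symmetric]) (simp add: walsh_orthogonal)
  also have "\<dots> = (\<Sum>u\<in>Pow X. if u = t then h u else 0)"
    by (intro sum.cong) auto
  also have "\<dots> = h t" using X by simp
  finally show ?thesis .
qed


section \<open>A rapidly growing sequence\<close>

lemma set_decode_power2_minus_1: "set_decode (2 ^ s - 1) = {..<s}"
proof -
  have "set_encode {..<s} = 2 ^ s - 1"
    by (simp add: set_encode_def lessThan_atLeast0 sum_power2)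
  then show ?thesis by (metis finite_lessThan set_encode_inverse)
qed

lemma set_decode_subset_lessThan_iff: "set_decode j \<subseteq> {..<s} \<longleftrightarrow> j < 2 ^ s"
proof
  assume "set_decode j \<subseteq> {..<s}"
  then have "j \<le> 2 ^ s - 1"
    by (intro subset_decode_imp_le) (simp only: set_decode_power2_minus_1)
  then show "j < 2 ^ s" using zero_less_power[of "2 :: nat" s] by linarith
next
  assume j: "j < 2 ^ s"
  have "i < s" if "i \<in> set_decode j" for i
  proof -
    have "set_decode (2 ^ i) \<subseteq> set_decode j"
      using that set_encode_inverse[of "{i}"] by simp
    then have "2 ^ i < (2 :: nat) ^ s" using j subset_decode_imp_le le_less_trans by blast
    then show ?thesis by simp
  qed
  then show "set_decode j \<subseteq> {..<s}" by auto
qed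

lemma set_decode_inject [simp]: "set_decode i = set_decode j \<longleftrightarrow> i = j"
  by (metis set_decode_inverse)

lemma psubset_decode_imp_less: "set_decode i \<subset> set_decode j \<Longrightarrow> i < j"
  using subset_decode_imp_le[of i j] by (auto simp: less_le psubset_eq)

lemma bij_betw_set_decode_Pow:
  "finite A \<Longrightarrow> bij_betw set_decode {i. set_decode i \<subseteq> A} (Pow A)"
  by (rule bij_betw_byWitness[where f' = set_encode]) (auto simp: finite_subset)

lemma finite_subset_decode [simp]: "finite {i. set_decode i \<subseteq> set_decode j}"
  using bij_betw_finite[OF bij_betw_set_decode_Pow[OF finite_set_decode[of j]]] by simp

lemma psubset_decode_eq: "{i. set_decode i \<subset> set_decode j} = {i. set_decode i \<subseteq> set_decode j} - {j}"
  by (auto simp: psubset_eq)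

lemma card_psubset_decode:
  "real (card {i. set_decode i \<subset> set_decode j}) = 2 ^ card (set_decode j) - 1"
proof -
  have "card {i. set_decode i \<subseteq> set_decode j} = 2 ^ card (set_decode j)"
    using bij_betw_same_card[OF bij_betw_set_decode_Pow[OF finite_set_decode[of j]]]
    by (simp add: card_Pow)
  then show ?thesis by (simp add: psubset_decode_eq)
qed

text \<open>The recursion makes the functional \<open>pairing\<close> below vanish on \<open>growth_row\<close>; each step
  multiplies by at least \<open>2 ^ (card (set_decode j) + 1)\<close>.\<close>

function chain_coeff :: "nat \<Rightarrow> real" where
  "chain_coeff 0 = 1"
| "chain_coeff (Suc j) = (2 ^ (card (set_decode j) + 2) - 1) * chain_coeff j
     - (\<Sum>i | set_decode i \<subset> set_decode j. chain_coeff i + chain_coeff (Suc i))"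
  by pat_completeness auto
termination
  by (relation "Wellfounded.measure id") (simp_all add: psubset_decode_imp_less less_SucI)

declare chain_coeff.simps(2) [simp del] \<comment> \<open>loops: \<open>chain_coeff (Suc i)\<close> recurs under the sum\<close>

lemma sum_chain_coeff:
  "(\<Sum>i | set_decode i \<subseteq> set_decode j. chain_coeff i + chain_coeff (Suc i))
    = 2 ^ (card (set_decode j) + 2) * chain_coeff j"
  using sum.remove[of "{i. set_decode i \<subseteq> set_decode j}" j
      "\<lambda>i. chain_coeff i + chain_coeff (Suc i)"]
  by (simp add: chain_coeff.simps(2)[of j] psubset_decode_eq algebra_simps)

lemma chain_coeff_Suc_ge_if_max:
  assumes nonneg: "0 \<le> chain_coeff j" and max: "\<And>i. i \<le> j \<Longrightarrow> chain_coeff i \<le> chain_coeff j"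
  shows "2 ^ (card (set_decode j) + 1) * chain_coeff j \<le> chain_coeff (Suc j)"
proof -
  let ?S = "{i. set_decode i \<subset> set_decode j}" and ?d = "card (set_decode j)"
  have "chain_coeff i + chain_coeff (Suc i) \<le> 2 * chain_coeff j" if "i \<in> ?S" for i
    using max[of i] max[of "Suc i"] psubset_decode_imp_less[of i j] that by simp
  then have "(\<Sum>i\<in>?S. chain_coeff i + chain_coeff (Suc i)) \<le> real (card ?S) * (2 * chain_coeff j)"
    by (rule sum_bounded_above)
  also have "\<dots> = (2 ^ ?d - 1) * (2 * chain_coeff j)" by (simp only: card_psubset_decode)
  finally have "(2 ^ (?d + 2) - 1) * chain_coeff j - (2 ^ ?d - 1) * (2 * chain_coeff j)
      \<le> chain_coeff (Suc j)"
    by (simp add: chain_coeff.simps(2)[of j])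
  then show ?thesis using nonneg by (simp add: algebra_simps)
qed

lemma chain_coeff_pos_max: "0 < chain_coeff j \<and> (\<forall>i\<le>j. chain_coeff i \<le> chain_coeff j)"
proof (induction j)
  case (Suc j)
  have "1 * chain_coeff j \<le> 2 ^ (card (set_decode j) + 1) * chain_coeff j"
    using Suc by (intro mult_right_mono one_le_power) auto
  also have "\<dots> \<le> chain_coeff (Suc j)"
    using Suc by (intro chain_coeff_Suc_ge_if_max) auto
  finally show ?case using Suc by (auto simp: le_Suc_eq intro: order_trans)
qed simp

lemma chain_coeff_pos: "0 < chain_coeff j"
  using chain_coeff_pos_max by blast

lemma chain_coeff_Suc_ge: "2 ^ (card (set_decode j) + 1) * chain_coeff j \<le> chain_coeff (Suc j)"
  using chain_coeff_pos_max[of j] by (intro chain_coeff_Suc_ge_if_max) auto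

lemma chain_coeff_ge_power_sum: "2 ^ (\<Sum>j<m. card (set_decode j) + 1) \<le> chain_coeff m"
proof (induction m)
  case (Suc m)
  have "2 ^ (\<Sum>j<Suc m. card (set_decode j) + 1)
      = 2 ^ (card (set_decode m) + 1) * (2 ^ (\<Sum>j<m. card (set_decode j) + 1) :: real)"
    by (simp add: power_add)
  also have "\<dots> \<le> 2 ^ (card (set_decode m) + 1) * chain_coeff m"
    using Suc by (intro mult_left_mono) auto
  finally show ?case using chain_coeff_Suc_ge[of m] by linarith
qed simp

lemma sum_card_Pow:
  assumes "finite X"
  shows "2 * (\<Sum>y\<in>Pow X. card y) = card X * 2 ^ card X"
proof -
  have "(\<Sum>y\<in>Pow X. card y) = (\<Sum>y\<in>Pow X. card (X - y))"
    by (rule sum.reindex_bij_witness[of _ "\<lambda>y. X - y" "\<lambda>y. X - y"])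
      (auto simp: double_diff)
  then have "2 * (\<Sum>y\<in>Pow X. card y) = (\<Sum>y\<in>Pow X. card y + card (X - y))"
    by (simp add: sum.distrib)
  also have "\<dots> = (\<Sum>y\<in>Pow X. card X)"
    using assms by (intro sum.cong refl) (auto simp: card_Diff_subset finite_subset card_mono)
  finally show ?thesis using assms by (simp add: card_Pow)
qed

lemma chain_coeff_power2_ge: "2 powr (2 ^ s * (real s + 2) / 2) \<le> chain_coeff (2 ^ s)"
proof -
  let ?e = "\<Sum>j<2 ^ s. card (set_decode j) + 1"
  have "bij_betw set_decode {..<2 ^ s} (Pow {..<s})"
    using bij_betw_set_decode_Pow[of "{..<s}"]
    by (simp only: set_decode_subset_lessThan_iff lessThan_def[of "2 ^ s"] finite_lessThan)
  then have "?e = (\<Sum>y\<in>Pow {..<s}. card y + 1)"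
    by (rule sum.reindex_bij_betw)
  then have "2 * ?e = 2 ^ s * (s + 2)"
    using sum_card_Pow[of "{..<s}"] unfolding sum.distrib by (simp add: card_Pow algebra_simps)
  then have "real (2 * ?e) = real (2 ^ s * (s + 2))" by (rule arg_cong)
  then have "2 * real ?e = 2 ^ s * (real s + 2)"
    by (simp only: of_nat_mult of_nat_add of_nat_power of_nat_numeral)
  then have "2 ^ s * (real s + 2) / 2 = real ?e" by linarith
  then have "2 powr (2 ^ s * (real s + 2) / 2) = 2 powr real ?e" by (rule arg_cong)
  also have "\<dots> = 2 ^ ?e" by (rule powr_realpow) simp
  also have "\<dots> \<le> chain_coeff (2 ^ s)" by (rule chain_coeff_ge_power_sum)
  finally show ?thesis .
qed

section \<open>An ill-conditioned sign matrix\<close>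

interpretation real_fun: vector_space "\<lambda>r f t. r * f t :: real"
  by unfold_locales (auto simp: fun_eq_iff algebra_simps)

lemma sum_fun_apply: "(\<Sum>x\<in>A. f x) t = (\<Sum>x\<in>A. f x t)"
  for f :: "'a \<Rightarrow> 'b \<Rightarrow> 'c :: comm_monoid_add"
  by (induction A rule: infinite_finite_induct) auto

context
  fixes s :: nat
begin

abbreviation ground :: "nat set" where
  "ground \<equiv> {..<s + 3}"

text \<open>The active sets form the chain \<open>lower 0, upper 0, lower 1, upper 1, \<dots>\<close>. The prescribed Walsh
  transform grows from \<open>lower j\<close> to \<open>upper j\<close>, as enforced by \<open>growth_row j\<close>, and is carried over
  unchanged from \<open>upper j\<close> to \<open>lower (Suc j)\<close>, as enforced by \<open>link_row j\<close>. The latter has values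
  \<open>\<plusminus>1\<close> because \<open>(x - y + 1 + x y) / 2\<close> is \<open>1\<close> for \<open>x = 1\<close> and \<open>-y\<close> for \<open>x = -1\<close>.\<close>

definition active :: "nat set \<Rightarrow> bool" where
  "active b \<longleftrightarrow> {s, s + 1} \<subseteq> b"

definition lower :: "nat \<Rightarrow> nat set" where
  "lower j = {s, s + 1} \<union> set_decode j"

definition upper :: "nat \<Rightarrow> nat set" where
  "upper j = insert (s + 2) (lower j)"

definition spectrum :: "nat set \<Rightarrow> real" where
  "spectrum b =
     (if active b then chain_coeff (set_encode (b \<inter> {..<s}) + of_bool (s + 2 \<in> b)) else 0)"

definition weight :: "nat set \<Rightarrow> real" where
  "weight t = (\<Sum>b\<in>Pow ground. spectrum b * walsh t b) / 2 ^ card ground"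

definition pairing :: "(nat set \<Rightarrow> real) \<Rightarrow> real" where
  "pairing f = (\<Sum>t\<in>Pow ground. weight t * f t)"

definition link_row :: "nat \<Rightarrow> nat set \<Rightarrow> real" where
  "link_row j t = (walsh (lower (Suc j)) t - walsh (upper j) t + 1
     + walsh (sym_diff (lower (Suc j)) (upper j)) t) / 2"

definition growth_row :: "nat \<Rightarrow> nat set \<Rightarrow> real" where
  "growth_row j t = 2 * of_bool (upper j \<inter> t = {}) - walsh (lower j) t"

definition sign_rows :: "(nat set \<Rightarrow> real) set" where
  "sign_rows = walsh ` insert (lower 0) {b. b \<subseteq> ground \<and> \<not> active b}
     \<union> link_row ` {j. Suc j < 2 ^ s} \<union> growth_row ` {..<2 ^ s}"

lemma finite_lower [simp]: "finite (lower j)" and finite_upper [simp]: "finite (upper j)"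
  by (simp_all add: lower_def upper_def)

lemma lower_subset_upper: "lower j \<subseteq> upper j"
  by (auto simp: upper_def)

lemma upper_subset_ground: "j < 2 ^ s \<Longrightarrow> upper j \<subseteq> ground"
  using set_decode_subset_lessThan_iff[of j s] by (auto simp: upper_def lower_def)

lemma upper_last_eq_ground: "upper (2 ^ s - 1) = ground"
  unfolding upper_def lower_def set_decode_power2_minus_1 by auto

lemma lower_Int:
  assumes "j < 2 ^ s"
  shows "lower j \<inter> {..<s} = set_decode j"
  using set_decode_subset_lessThan_iff[of j s] assms
  by (auto simp: lower_def simp del: set_decode_Suc)

lemma notin_lower:
  assumes "j < 2 ^ s"
  shows "s + 2 \<notin> lower j"
  using set_decode_subset_lessThan_iff[of j s] assms
  by (auto simp: lower_def simp del: set_decode_Suc)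

lemma upper_Int: "j < 2 ^ s \<Longrightarrow> upper j \<inter> {..<s} = set_decode j"
  using lower_Int[of j] by (simp add: upper_def)

lemma last_in_upper: "s + 2 \<in> upper j"
  by (simp add: upper_def)

lemma card_upper:
  assumes "j < 2 ^ s"
  shows "card (upper j) = card (set_decode j) + 3"
proof -
  have "card (lower j) = card {s, s + 1} + card (set_decode j)"
    unfolding lower_def using set_decode_subset_lessThan_iff[of j s] assms
    by (intro card_Un_disjoint) (auto simp del: set_decode_Suc)
  then show ?thesis using notin_lower[OF assms] by (simp add: upper_def)
qed

lemma active_lower [simp]: "active (lower j)" and active_upper [simp]: "active (upper j)"
  by (auto simp: active_def lower_def upper_def)

lemma not_active_sym_diff: "active a \<Longrightarrow> active b \<Longrightarrow> \<not> active (sym_diff a b)"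
  by (auto simp: active_def)

lemma active_subsets_upper:
  assumes j: "j < 2 ^ s"
  shows "{b. b \<subseteq> upper j \<and> active b}
    = lower ` {i. set_decode i \<subseteq> set_decode j} \<union> upper ` {i. set_decode i \<subseteq> set_decode j}"
    (is "?A = lower ` ?I \<union> upper ` ?I")
proof
  show "?A \<subseteq> lower ` ?I \<union> upper ` ?I"
  proof
    fix b assume b: "b \<in> ?A"
    define i where "i = set_encode (b \<inter> {..<s})"
    have i: "set_decode i = b \<inter> {..<s}" by (simp add: i_def)
    have "i \<in> ?I" using i b upper_Int[OF j] by blast
    moreover have "b = lower i \<or> b = upper i"
      using b set_decode_subset_lessThan_iff[of j s] j
      by (auto simp: active_def i lower_def upper_def)
    ultimately show "b \<in> lower ` ?I \<union> upper ` ?I" by blast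
  qed
  show "lower ` ?I \<union> upper ` ?I \<subseteq> ?A"
    by (auto simp: lower_def upper_def active_def)
qed

lemma spectrum_lower: "j < 2 ^ s \<Longrightarrow> spectrum (lower j) = chain_coeff j"
  using notin_lower[of j] by (simp add: spectrum_def lower_Int)

lemma spectrum_upper: "j < 2 ^ s \<Longrightarrow> spectrum (upper j) = chain_coeff (Suc j)"
  using last_in_upper[of j] by (simp add: spectrum_def upper_Int)

lemma spectrum_nonneg: "0 \<le> spectrum b"
  by (simp add: spectrum_def chain_coeff_pos less_imp_le)

lemma sum_spectrum_upper:
  assumes j: "j < 2 ^ s"
  shows "(\<Sum>b\<in>Pow (upper j). spectrum b) = 2 ^ (card (set_decode j) + 2) * chain_coeff j"
proof -
  let ?I = "{i. set_decode i \<subseteq> set_decode j}"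
  have bound: "i < 2 ^ s" if "i \<in> ?I" for i
    using that subset_decode_imp_le[of i j] j by simp
  have inj: "inj_on lower ?I" "inj_on upper ?I"
    by (rule inj_on_inverseI[where g = "\<lambda>b. set_encode (b \<inter> {..<s})"];
        simp only: lower_Int[OF bound] upper_Int[OF bound] set_decode_inverse)+
  have disjoint: "lower ` ?I \<inter> upper ` ?I = {}"
  proof -
    have "s + 2 \<notin> b" if "b \<in> lower ` ?I" for b using that notin_lower bound by blast
    moreover have "s + 2 \<in> b" if "b \<in> upper ` ?I" for b using that last_in_upper by auto
    ultimately show ?thesis by blast
  qed
  have "(\<Sum>b\<in>Pow (upper j). spectrum b) = (\<Sum>b\<in>lower ` ?I \<union> upper ` ?I. spectrum b)"
    unfolding active_subsets_upper[OF j, symmetric]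
    by (rule sum.mono_neutral_right) (auto simp: spectrum_def)
  also have "\<dots> = (\<Sum>i\<in>?I. spectrum (lower i)) + (\<Sum>i\<in>?I. spectrum (upper i))"
    using disjoint by (simp add: sum.union_disjoint sum.reindex inj o_def)
  also have "\<dots> = (\<Sum>i\<in>?I. chain_coeff i + chain_coeff (Suc i))"
    unfolding sum.distrib[symmetric]
    by (intro sum.cong refl) (simp only: spectrum_lower[OF bound] spectrum_upper[OF bound])
  finally show ?thesis by (simp only: sum_chain_coeff)
qed

lemma growth_row_eq:
  assumes "j < 2 ^ s"
  shows "growth_row j t
    = (\<Sum>b\<in>Pow (upper j). walsh b t) / 2 ^ (card (set_decode j) + 2) - walsh (lower j) t"
  by (simp add: growth_row_def sum_walsh_Pow card_upper[OF assms] power_add)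

lemma sign_rows_sign:
  assumes "r \<in> sign_rows"
  shows "r t \<in> {1, -1}"
proof -
  have "link_row j t \<in> {1, -1}" for j
    using walsh_cases[of "lower (Suc j)" t] walsh_cases[of "upper j" t]
    by (auto simp: link_row_def simp flip: walsh_mult)
  moreover have "walsh (lower j) t = 1" if "upper j \<inter> t = {}" for j
    using that by (simp add: upper_def walsh_def Int_insert_left split: if_splits)
  then have "growth_row j t \<in> {1, -1}" for j
    using walsh_cases[of "lower j" t] by (auto simp: growth_row_def)
  ultimately show ?thesis using assms walsh_cases by (auto simp: sign_rows_def)
qed

lemma sign_rows_at_empty: "r \<in> sign_rows \<Longrightarrow> r {} = 1"
  by (auto simp: sign_rows_def link_row_def growth_row_def)

lemma finite_sign_rows: "finite sign_rows"
proof -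
  have "{j. Suc j < 2 ^ s} \<subseteq> {..<2 ^ s}" by auto
  then have "finite {j. Suc j < 2 ^ s}" by (rule finite_subset) simp
  then show ?thesis by (simp add: sign_rows_def)
qed

lemma card_sign_rows_le: "card sign_rows \<le> 10 * 2 ^ s"
proof -
  let ?L = "link_row ` {..<2 ^ s}" and ?G = "growth_row ` {..<2 ^ s}"
  have "insert (lower 0) {b. b \<subseteq> ground \<and> \<not> active b} \<subseteq> Pow ground"
    by (auto simp: lower_def)
  then have "sign_rows \<subseteq> walsh ` Pow ground \<union> ?L \<union> ?G"
    unfolding sign_rows_def by (intro Un_mono image_mono) auto
  then have "card sign_rows \<le> card (walsh ` Pow ground \<union> ?L \<union> ?G)"
    by (intro card_mono) auto
  also have "\<dots> \<le> card (walsh ` Pow ground) + card ?L + card ?G"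
    by (intro order_trans[OF card_Un_le] add_mono card_Un_le) simp
  also have "\<dots> \<le> card (Pow ground) + card {..<2 ^ s :: nat} + card {..<2 ^ s :: nat}"
    by (intro add_mono card_image_le) auto
  finally show ?thesis by (simp add: card_Pow power_add)
qed

lemma pairing_walsh:
  assumes "b \<subseteq> ground"
  shows "pairing (walsh b) = spectrum b"
  using walsh_inversion[of ground b spectrum] assms
  by (simp add: pairing_def weight_def walsh_commute[of b])

lemma pairing_link_row:
  assumes j: "Suc j < 2 ^ s"
  shows "pairing (link_row j) = 0"
proof -
  let ?D = "sym_diff (lower (Suc j)) (upper j)"
  have sub: "lower (Suc j) \<subseteq> ground" "upper j \<subseteq> ground"
    using upper_subset_ground[of j] upper_subset_ground[OF j] lower_subset_upper j by auto
  have "pairing (link_row j) = (pairing (walsh (lower (Suc j))) - pairing (walsh (upper j))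
      + pairing (walsh {}) + pairing (walsh ?D)) / 2"
    by (simp add: pairing_def link_row_def sum_divide_distrib algebra_simps
        flip: sum_subtractf sum.distrib)
  also have "\<dots> = (spectrum (lower (Suc j)) - spectrum (upper j) + spectrum {} + spectrum ?D) / 2"
    using sub by (subst (1 2 3 4) pairing_walsh) auto
  also have "spectrum {} = 0" by (simp add: spectrum_def active_def)
  also have "spectrum ?D = 0" by (simp add: spectrum_def not_active_sym_diff)
  also have "spectrum (lower (Suc j)) = spectrum (upper j)"
    using j by (simp add: spectrum_lower spectrum_upper)
  finally show ?thesis by simp
qed

lemma pairing_growth_row:
  assumes j: "j < 2 ^ s"
  shows "pairing (growth_row j) = 0"
proof -
  let ?d = "card (set_decode j) + 2"
  have sub: "b \<subseteq> ground" if "b \<subseteq> upper j" for b using that upper_subset_ground[OF j] by auto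
  have "pairing (growth_row j) = (\<Sum>t\<in>Pow ground. \<Sum>b\<in>Pow (upper j). weight t * walsh b t) / 2 ^ ?d
      - pairing (walsh (lower j))"
    by (simp add: pairing_def growth_row_eq[OF j] right_diff_distrib sum_subtractf
        sum_divide_distrib sum_distrib_left)
  also have "(\<Sum>t\<in>Pow ground. \<Sum>b\<in>Pow (upper j). weight t * walsh b t)
      = (\<Sum>b\<in>Pow (upper j). pairing (walsh b))"
    unfolding pairing_def by (rule sum.swap)
  also have "\<dots> = (\<Sum>b\<in>Pow (upper j). spectrum b)"
    by (intro sum.cong refl pairing_walsh sub) simp
  also have "\<dots> = 2 ^ ?d * chain_coeff j" by (rule sum_spectrum_upper[OF j])
  also have "pairing (walsh (lower j)) = chain_coeff j"
    using j by (simp add: pairing_walsh sub lower_subset_upper spectrum_lower)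
  finally show ?thesis by simp
qed

lemma abs_pairing_sign_rows_le:
  assumes "r \<in> sign_rows"
  shows "\<bar>pairing r\<bar> \<le> 1"
proof -
  have "lower 0 \<subseteq> ground" by (auto simp: lower_def)
  then have "pairing (walsh (lower 0)) = 1" using spectrum_lower[of 0] by (simp add: pairing_walsh)
  moreover have "pairing (walsh b) = 0" if "b \<subseteq> ground" "\<not> active b" for b
    using that by (simp add: pairing_walsh spectrum_def)
  ultimately show ?thesis
    using assms by (auto simp: sign_rows_def pairing_link_row pairing_growth_row)
qed

lemma weight_empty_nonneg: "0 \<le> weight {}"
  by (simp add: weight_def sum_nonneg spectrum_nonneg)

lemma chain_coeff_le_sum_abs_weight: "chain_coeff (2 ^ s) \<le> (\<Sum>t\<in>Pow ground. \<bar>weight t\<bar>)"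
proof -
  have "chain_coeff (2 ^ s) = pairing (walsh ground)"
    using spectrum_upper[of "2 ^ s - 1"] unfolding upper_last_eq_ground by (simp add: pairing_walsh)
  also have "\<dots> \<le> (\<Sum>t\<in>Pow ground. \<bar>weight t\<bar>)"
    unfolding pairing_def
  proof (rule sum_mono)
    fix t
    show "weight t * walsh ground t \<le> \<bar>weight t\<bar>" using walsh_cases[of ground t] by auto
  qed
  finally show ?thesis .
qed

abbreviation row_space :: "(nat set \<Rightarrow> real) set" where
  "row_space \<equiv> real_fun.span sign_rows"

lemma walsh_inactive_in_row_space: "b \<subseteq> ground \<Longrightarrow> \<not> active b \<Longrightarrow> walsh b \<in> row_space"
  by (intro real_fun.span_base) (auto simp: sign_rows_def)

lemma walsh_lower_Suc_in_row_space:
  assumes j: "Suc j < 2 ^ s" and upper: "walsh (upper j) \<in> row_space"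
  shows "walsh (lower (Suc j)) \<in> row_space"
proof -
  let ?D = "sym_diff (lower (Suc j)) (upper j)"
  have "?D \<subseteq> ground"
    using upper_subset_ground[of j] upper_subset_ground[OF j] lower_subset_upper j by fastforce
  then have "walsh ?D \<in> row_space"
    by (intro walsh_inactive_in_row_space not_active_sym_diff) auto
  moreover have "walsh {} \<in> row_space"
    by (rule walsh_inactive_in_row_space) (auto simp: active_def)
  moreover have "link_row j \<in> row_space"
    using j by (intro real_fun.span_base) (auto simp: sign_rows_def)
  ultimately have "(\<lambda>t. 2 * link_row j t) + walsh (upper j) - walsh {} - walsh ?D \<in> row_space"
    by (intro real_fun.span_diff real_fun.span_add real_fun.span_scale upper)
  also have "(\<lambda>t. 2 * link_row j t) + walsh (upper j) - walsh {} - walsh ?D = walsh (lower (Suc j))"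
    by (rule ext) (simp add: link_row_def field_simps)
  finally show ?thesis .
qed

lemma walsh_upper_in_row_space:
  assumes j: "j < 2 ^ s"
    and subsets: "\<And>b. b \<subset> upper j \<Longrightarrow> walsh b \<in> row_space"
  shows "walsh (upper j) \<in> row_space"
proof -
  let ?f = "\<lambda>t. 2 ^ (card (set_decode j) + 2) * (growth_row j + walsh (lower j)) t"
    and ?S = "Pow (upper j) - {upper j}"
  have "lower j \<subset> upper j" using notin_lower[OF j] by (auto simp: upper_def)
  then have "walsh (lower j) \<in> row_space" by (rule subsets)
  moreover have "growth_row j \<in> row_space"
    using j by (intro real_fun.span_base) (auto simp: sign_rows_def)
  moreover have "(\<Sum>b\<in>?S. walsh b) \<in> row_space"
    by (intro real_fun.span_sum subsets) auto
  ultimately have "?f - (\<Sum>b\<in>?S. walsh b) \<in> row_space"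
    by (intro real_fun.span_diff real_fun.span_add real_fun.span_scale)
  also have "?f - (\<Sum>b\<in>?S. walsh b) = walsh (upper j)"
  proof
    fix t
    have "(\<Sum>b\<in>Pow (upper j). walsh b t) = walsh (upper j) t + (\<Sum>b\<in>?S. walsh b t)"
      by (intro sum.remove) auto
    then show "(?f - (\<Sum>b\<in>?S. walsh b)) t = walsh (upper j) t"
      by (simp add: growth_row_eq[OF j] sum_fun_apply)
  qed
  finally show ?thesis .
qed

lemma walsh_lower_upper_in_row_space:
  "j < 2 ^ s \<Longrightarrow> walsh (lower j) \<in> row_space \<and> walsh (upper j) \<in> row_space"
proof (induction j rule: less_induct)
  case (less j)
  have lower: "walsh (lower j) \<in> row_space"
  proof (cases j)
    case 0
    then show ?thesis by (auto simp: sign_rows_def intro: real_fun.span_base)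
  next
    case (Suc i)
    then show ?thesis using less by (auto intro: walsh_lower_Suc_in_row_space)
  qed
  moreover have "walsh (upper j) \<in> row_space"
  proof (rule walsh_upper_in_row_space[OF less.prems])
    fix b assume b: "b \<subset> upper j"
    have IH: "walsh (lower i) \<in> row_space" "walsh (upper i) \<in> row_space"
      if "set_decode i \<subseteq> set_decode j" "i \<noteq> j" for i
      using less.IH[of i] less.prems subset_decode_imp_le[of i j] that by auto
    show "walsh b \<in> row_space"
    proof (cases "active b")
      case True
      then obtain i where i: "set_decode i \<subseteq> set_decode j" "b = lower i \<or> b = upper i"
        using active_subsets_upper[OF less.prems] b by blast
      then show ?thesis using IH[OF i(1)] lower b by (cases "i = j") auto
    next
      case False
      then show ?thesis
        using b upper_subset_ground[OF less.prems] by (intro walsh_inactive_in_row_space) auto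
    qed
  qed
  ultimately show ?case ..
qed

lemma walsh_in_row_space:
  assumes b: "b \<subseteq> ground"
  shows "walsh b \<in> row_space"
proof (cases "active b")
  case True
  have last: "(2 :: nat) ^ s - 1 < 2 ^ s" by simp
  have bound: "i < 2 ^ s" if "set_decode i \<subseteq> set_decode (2 ^ s - 1)" for i
    using that unfolding set_decode_power2_minus_1 set_decode_subset_lessThan_iff .
  have "b \<subseteq> upper (2 ^ s - 1)" using b unfolding upper_last_eq_ground .
  then obtain i where "set_decode i \<subseteq> set_decode (2 ^ s - 1)" "b = lower i \<or> b = upper i"
    using active_subsets_upper[OF last] True by blast
  then show ?thesis using walsh_lower_upper_in_row_space[OF bound] by blast
qed (use b walsh_inactive_in_row_space in auto)

lemma sign_rows_spanning: "\<exists>c. \<forall>t\<in>Pow ground. (\<Sum>r\<in>sign_rows. c r * r t) = h t"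
proof -
  let ?H = "\<Sum>a\<in>Pow ground.
    (\<lambda>t. (\<Sum>u\<in>Pow ground. h u * walsh a u) / 2 ^ card ground * walsh a t)"
  have "?H \<in> row_space"
    by (intro real_fun.span_sum real_fun.span_scale walsh_in_row_space) auto
  then obtain c where "?H = (\<Sum>r\<in>sign_rows. (\<lambda>t. c r * r t))"
    by (auto simp: real_fun.span_finite[OF finite_sign_rows])
  then have "(\<Sum>r\<in>sign_rows. c r * r t) = ?H t" for t by (simp add: sum_fun_apply)
  then have "(\<Sum>r\<in>sign_rows. c r * r t) = h t" if "t \<in> Pow ground" for t
    using walsh_inversion[of ground t h] that by (simp add: sum_fun_apply)
  then show ?thesis by blast
qed

end

lemma exists_local_correction_of_dimension:
  fixes \<delta> :: real
  assumes n: "0 < n" "real n \<le> 2 powr (2 ^ s * (real s + 2) / 2)" and \<delta>: "120 * 2 ^ s * \<delta> \<le> 1"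
  obtains q where "real q \<le> 10 * 2 ^ s" "has_local_correction n (poly_deg_le_1 n) \<delta> q"
proof
  show card_le: "real (card (sign_rows s)) \<le> 10 * 2 ^ s"
    using of_nat_mono[OF card_sign_rows_le[of s], where 'a = real] by simp
  show "has_local_correction n (poly_deg_le_1 n) \<delta> (card (sign_rows s))"
  proof (rule has_local_correction_of_ill_conditioned_rows
      [where w = "weight s" and T = "Pow (ground s)" and u = "{}"])
    show "real n \<le> (\<Sum>t\<in>Pow (ground s). \<bar>weight s t\<bar>)"
      using n(2) chain_coeff_power2_ge[of s] chain_coeff_le_sum_abs_weight[of s] by linarith
    show "\<bar>\<Sum>t\<in>Pow (ground s). weight s t * r t\<bar> \<le> 1" if "r \<in> sign_rows s" for r
      using abs_pairing_sign_rows_le[OF that] by (simp add: pairing_def)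
    show "card (sign_rows s) * (3 * \<delta>) \<le> 1 / 4"
    proof (cases "0 \<le> \<delta>")
      case True
      then have "card (sign_rows s) * (3 * \<delta>) \<le> 10 * 2 ^ s * (3 * \<delta>)"
        by (intro mult_right_mono card_le) simp
      then show ?thesis using \<delta> by linarith
    next
      case False
      then have "card (sign_rows s) * (3 * \<delta>) \<le> 0" by (intro mult_nonneg_nonpos) auto
      then show ?thesis by linarith
    qed
  qed (use n finite_sign_rows sign_rows_sign sign_rows_at_empty sign_rows_spanning
      weight_empty_nonneg in auto)
qed

lemma exists_dimension_for_log:
  fixes L :: real
  assumes L: "1 < L"
  obtains s :: nat where "L \<le> 2 ^ s * (real s + 2) / 2" "2 ^ s * log 2 L \<le> 8 * L"
proof -
  define Q where "Q s \<longleftrightarrow> L \<le> 2 ^ s * (real s + 2) / 2" for s :: nat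
  obtain m where m: "2 * L < real m" using reals_Archimedean2 by blast
  have "1 * real m \<le> 2 ^ m * (real m + 2)" by (intro mult_mono) auto
  then have "Q m" using m by (simp add: Q_def)
  moreover have "\<not> Q 0" using L by (simp add: Q_def)
  ultimately obtain u where u: "\<not> Q u" "Q (Suc u)" using ex_least_nat_less[of Q] by blast
  have "real (Suc u + 2) \<le> real (2 * 2 ^ Suc u)"
    unfolding of_nat_le_iff using less_exp[of "Suc u"] by simp
  then have "2 ^ Suc u * (real (Suc u) + 2) \<le> 2 ^ Suc u * (2 * 2 ^ Suc u)"
    by (intro mult_left_mono) auto
  then have "L \<le> 2 ^ Suc u * 2 ^ Suc u" using u(2) unfolding Q_def by linarith
  also have "\<dots> = 2 powr real (2 * Suc u)" by (subst powr_realpow) (simp_all only: mult_2 power_add)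
  finally have "L \<le> 2 powr real (2 * Suc u)" .
  then have "log 2 L \<le> real (2 * Suc u)" using L by (subst log_le_iff) simp_all
  then have "log 2 L \<le> 2 * (real u + 2)" by simp
  then have "2 ^ Suc u * log 2 L \<le> 2 ^ Suc u * (2 * (real u + 2))"
    by (intro mult_left_mono) auto
  also have "\<dots> = 8 * (2 ^ u * (real u + 2) / 2)" by simp
  also have "\<dots> \<le> 8 * L" using u(1) unfolding Q_def by linarith
  finally show thesis using u(2) unfolding Q_def by (rule that[rotated])
qed

theorem theoremB1:
  "\<exists>c > (0::real). \<exists>C > (0::real). \<forall>n \<ge> (3::nat). \<forall>\<delta> :: real.
     \<delta> < c * log 2 (log 2 (real n)) / log 2 (real n) \<longrightarrow>
     (\<exists>q :: nat. real q \<le> C * log 2 (real n) / log 2 (log 2 (real n)) \<and>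
        has_local_correction n (poly_deg_le_1 n) \<delta> q)"
proof (rule exI[of _ "1 / 960"], rule conjI, simp, rule exI[of _ 80], intro conjI allI impI)
  fix n :: nat and \<delta> :: real
  define L where "L = log 2 (real n)"
  assume n: "3 \<le> n" and "\<delta> < 1 / 960 * log 2 (log 2 (real n)) / log 2 (real n)"
  then have \<delta>: "\<delta> \<le> log 2 L / (960 * L)" by (simp add: L_def)
  have "log 2 2 < L" unfolding L_def using n by (subst log_less_cancel_iff) auto
  then have L: "1 < L" "0 < log 2 L" by auto
  obtain s where s: "L \<le> 2 ^ s * (real s + 2) / 2" "2 ^ s * log 2 L \<le> 8 * L"
    using exists_dimension_for_log[OF L(1)] .
  have large: "real n \<le> 2 powr (2 ^ s * (real s + 2) / 2)"
    using powr_mono[OF s(1), of 2] n by (simp add: L_def)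
  have "120 * 2 ^ s * \<delta> \<le> 120 * 2 ^ s * (log 2 L / (960 * L))"
    using \<delta> by (rule mult_left_mono) simp
  also have "\<dots> \<le> 1" using s(2) L(1) by (simp add: pos_divide_le_eq)
  finally have "120 * 2 ^ s * \<delta> \<le> 1" .
  then obtain q where q: "real q \<le> 10 * 2 ^ s" "has_local_correction n (poly_deg_le_1 n) \<delta> q"
    using exists_local_correction_of_dimension[OF _ large] n by auto
  note q(1)
  also have "10 * 2 ^ s \<le> 80 * L / log 2 L" using s(2) L(2) by (simp add: pos_le_divide_eq)
  finally show "\<exists>q. real q \<le> 80 * log 2 (real n) / log 2 (log 2 (real n)) \<and>
      has_local_correction n (poly_deg_le_1 n) \<delta> q"
    using q(2) unfolding L_def by blast
qed simp

end
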